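(* Let $\mathcal{C}_1,\ldots,\mathcal{C}_m$ be closed convex sets of real symmetric $n\times n$ matrices, let $\epsilon>0$, and suppose we have access to $\epsilon$-separation oracles $O_{1,\epsilon},\ldots,O_{m,\epsilon}$ for $\mathcal C_1,\dots,\mathcal C_m$. Run the Hamiltonian Updates algorithm with $T=\lceil 16\log(n)/\epsilon^2\rceil+1$ iterations. Then either the algorithm returns (within these $T$ iterations) a state $\rho\in\mathcal{S}_n$ such that for every $i\in[m]$ there exists $Y_i\in\mathcal{C}_i$ with $\|Y_i-\rho\|_{tr}\le\epsilon$, or the feasibility problem is infeasible, i.e. $\mathcal{S}_n\cap\mathcal{C}_1\cap\cdots\cap\mathcal{C}_m=\emptyset$.
   Context: $\mathcal{S}_n=\{X\in\mathbb{R}^{n\times n}\text{ symmetric}: X\succeq0,\ \mathrm{tr}(X)=1\}$ is the set of $n$-dimensional (real) quantum states; $\|\cdot\|_{tr}$ is the trace norm and $\|\cdot\|$ the operator norm; $\log$ is the natural logarithm. An $\epsilon$-separation oracle for a closed convex set $\mathcal{C}$ is a subroutine which, on input $X$, either accepts $X$ (this happens if $\min_{Y\in\mathcal C}\|X-Y\|_{tr}\le\epsilon$), or otherwise outputs a symmetric matrix $P$ with $\|P\|\le1$ and $\mathrm{tr}(P(X-Y))\ge\epsilon$ for all $Y\in\mathcal{C}$. The Hamiltonian Updates algorithm: initialize $H=0$, $\rho=I/n$. For $t=1,\dots,T$: query the oracles $O_{1,\epsilon}(\rho),\dots,O_{m,\epsilon}(\rho)$ in order; at the first oracle $i$ that outputs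 a matrix $P$, update $H\leftarrow H+\tfrac{\epsilon}{8}P$ and $\rho\leftarrow e^{-H}/\mathrm{tr}(e^{-H})$ and proceed to the next iteration $t$; if all $m$ oracles accept $\rho$, return $(\rho,H)$ and stop. *)

theory Defs
  imports "HOL-Analysis.Analysis"
begin

definition symmetric_mat :: "real^'n^'n \<Rightarrow> bool" where
  "symmetric_mat A \<longleftrightarrow> transpose A = A"

definition psd :: "real^'n^'n \<Rightarrow> bool" where
  "psd A \<longleftrightarrow> symmetric_mat A \<and> (\<forall>x. 0 \<le> x \<bullet> (A *v x))"

definition quantum_states :: "(real^'n^'n) set" where
  "quantum_states = {X. psd X \<and> trace X = 1}"

definition operator_norm :: "real^'n^'n \<Rightarrow> real" where
  "operator_norm A = onorm ((*v) A)"

definition psd_sqrt :: "real^'n^'n \<Rightarrow> real^'n^'n" where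
  "psd_sqrt A = (THE S. psd S \<and> S ** S = A)"

definition trace_norm :: "real^'n^'n \<Rightarrow> real" where
  "trace_norm A = trace (psd_sqrt (transpose A ** A))"

text \<open>
  Multiplication on \<^typ>\<open>real^'n^'n\<close> in the type-class sense is componentwise, so neither \<open>^\<close> nor
  \<^const>\<open>exp\<close> is the matrix operation; power and exponential series are written with \<open>**\<close>.
\<close>

definition mat_power :: "real^'n^'n \<Rightarrow> nat \<Rightarrow> real^'n^'n" where
  "mat_power A k = (((**) A) ^^ k) (mat 1)"

definition mat_exp :: "real^'n^'n \<Rightarrow> real^'n^'n" where
  "mat_exp A = (\<Sum>k. (1 / fact k) *\<^sub>R mat_power A k)"

definition gibbs_state :: "real^'n^'n \<Rightarrow> real^'n^'n" where
  "gibbs_state H = (1 / trace (mat_exp (- H))) *\<^sub>R mat_exp (- H)"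

text \<open>
  An oracle answers \<^const>\<open>None\<close> to accept its input and \<open>Some P\<close> to output \<open>P\<close>.
  It accepts exactly when the minimal trace distance from the input to \<open>C\<close> is at most \<open>\<epsilon>\<close>;
  if \<open>C\<close> is empty there is no minimum and it never accepts.
\<close>

definition separation_oracle ::
  "real \<Rightarrow> (real^'n^'n) set \<Rightarrow> (real^'n^'n \<Rightarrow> (real^'n^'n) option) \<Rightarrow> bool" where
  "separation_oracle \<epsilon> C orc \<longleftrightarrow>
     (\<forall>X. symmetric_mat X \<longrightarrow>
        (case orc X of
           None \<Rightarrow>
             (\<exists>Y. is_arg_min (\<lambda>Y. trace_norm (X - Y)) (\<lambda>Y. Y \<in> C) Y \<and> trace_norm (X - Y) \<le> \<epsilon>)
         | Some P \<Rightarrow>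
             \<not> (\<exists>Y. is_arg_min (\<lambda>Y. trace_norm (X - Y)) (\<lambda>Y. Y \<in> C) Y \<and> trace_norm (X - Y) \<le> \<epsilon>) \<and>
             symmetric_mat P \<and> operator_norm P \<le> 1 \<and>
             (\<forall>Y\<in>C. trace (P ** (X - Y)) \<ge> \<epsilon>)))"

fun query_in_order :: "('a \<Rightarrow> 'b option) list \<Rightarrow> 'a \<Rightarrow> 'b option" where
  "query_in_order [] X = None"
| "query_in_order (orc # orcs) X =
     (case orc X of Some P \<Rightarrow> Some P | None \<Rightarrow> query_in_order orcs X)"

text \<open>
  The natural-number argument of \<open>hu_loop\<close> is the number of iterations left; the result
  \<^const>\<open>None\<close> means that they were used up without the algorithm returning a pair.
\<close>

fun hu_loop ::
  "(real^'n^'n \<Rightarrow> (real^'n^'n) option) list \<Rightarrow> real \<Rightarrow> nat \<Rightarrow> real^'n^'n \<Rightarrow> real^'n^'n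
    \<Rightarrow> ((real^'n^'n) \<times> (real^'n^'n)) option" where
  "hu_loop orcs \<epsilon> 0 H \<rho> = None"
| "hu_loop orcs \<epsilon> (Suc t) H \<rho> =
     (case query_in_order orcs \<rho> of
        None \<Rightarrow> Some (\<rho>, H)
      | Some P \<Rightarrow>
          (let H' = H + (\<epsilon> / 8) *\<^sub>R P in hu_loop orcs \<epsilon> t H' (gibbs_state H')))"

definition hamiltonian_updates ::
  "(real^'n^'n \<Rightarrow> (real^'n^'n) option) list \<Rightarrow> real \<Rightarrow> nat \<Rightarrow> ((real^'n^'n) \<times> (real^'n^'n)) option" where
  "hamiltonian_updates orcs \<epsilon> T = hu_loop orcs \<epsilon> T 0 ((1 / real CARD('n)) *\<^sub>R mat 1)"

end

theory Submission
  imports Defs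
begin

text \<open>
  Suppose \<open>Y\<close> is a state in all the sets, and let \<open>Z(H) = tr (exp (- H))\<close>. The potential
  \<open>ln Z(H) + tr (H Y)\<close> starts at \<open>ln n\<close>, is never negative, and drops by at least \<open>\<epsilon>\<^sup>2 / 16\<close> in each
  update, which bounds the number of updates.

  For the drop, let \<open>H' = H + \<eta> P\<close> with \<open>\<eta> = \<epsilon> / 8\<close>, let \<open>u\<^sub>i\<close>, \<open>v\<^sub>j\<close> be orthonormal eigenbases of
  \<open>-H\<close>, \<open>-H'\<close> with eigenvalues \<open>a\<^sub>i\<close>, \<open>b\<^sub>j\<close>, and average the scalar inequality
  \<open>e\<^sup>b - e\<^sup>a - e\<^sup>a (b - a) \<le> (b - a)\<^sup>2 (e\<^sup>a + e\<^sup>b)\<close> with the doubly stochastic weights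
  \<open>\<langle>u\<^sub>i, v\<^sub>j\<rangle>\<^sup>2\<close>. Since \<open>(b\<^sub>j - a\<^sub>i) \<langle>u\<^sub>i, v\<^sub>j\<rangle> = - \<eta> \<langle>u\<^sub>i, P v\<^sub>j\<rangle>\<close>, Parseval's identity evaluates both
  sides and gives \<open>Z(H') (1 - \<eta>\<^sup>2) \<le> Z(H) (1 + \<eta>\<^sup>2 - \<eta> tr (P \<rho>))\<close>. This replaces the
  Golden--Thompson inequality. Finally \<open>\<epsilon> \<le> 2\<close>, because \<open>\<epsilon> \<le> tr (P (\<rho> - Y)) \<le> 2\<close>.
\<close>

section \<open>The spectral theorem for real symmetric matrices\<close>

lemma symmetric_mat_inner_commute:
  fixes A :: "real^'n^'n"
  assumes "symmetric_mat A"
  shows "x \<bullet> (A *v y) = (A *v x) \<bullet> y"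
  using assms dot_lmul_matrix[of x A y] unfolding symmetric_mat_def
  by (metis transpose_matrix_vector)

text \<open>A maximiser \<open>u\<close> of the quadratic form on the unit sphere of
  \<open>S\<close> is an eigenvector: otherwise moving from \<open>u\<close> along the residual
  \<open>A *v u - c *\<^sub>R u\<close>, which stays in \<open>S\<close> by invariance, would raise
  the Rayleigh quotient to first order. Working inside an invariant subspace prepares the induction
  on dimension.\<close>

lemma symmetric_mat_eigenvector_exists:
  fixes A :: "real^'n^'n"
  assumes sym: "symmetric_mat A" and S: "subspace S" "S \<noteq> {0}"
    and inv: "\<And>x. x \<in> S \<Longrightarrow> A *v x \<in> S"
  obtains u c where "u \<in> S" "norm u = 1" "A *v u = c *\<^sub>R u"
proof -
  define K where "K = S \<inter> sphere 0 1"
  obtain z where z: "z \<in> S" "z \<noteq> 0" using S subspace_0 by blast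
  have "(1 / norm z) *\<^sub>R z \<in> K"
    unfolding K_def using z S by (simp add: subspace_scale)
  then have ne: "K \<noteq> {}" by blast
  have comp: "compact K" unfolding K_def
    using closed_subspace[OF S(1)] by (simp add: closed_Int_compact)
  have cont: "continuous_on K (\<lambda>x. x \<bullet> (A *v x))"
    by (intro continuous_on_inner continuous_on_id linear_continuous_on matrix_vector_mul_bounded_linear)
  obtain u where u: "u \<in> K" and mx: "\<And>x. x \<in> K \<Longrightarrow> x \<bullet> (A *v x) \<le> u \<bullet> (A *v u)"
    using continuous_attains_sup[OF comp ne cont] by blast
  define c where "c = u \<bullet> (A *v u)"
  define w where "w = A *v u - c *\<^sub>R u"
  have uS: "u \<in> S" and nu: "norm u = 1" using u by (auto simp: K_def)
  have uu: "u \<bullet> u = 1" using nu by (simp add: norm_eq_1)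
  have wS: "w \<in> S" unfolding w_def using uS inv S(1) by (simp add: subspace_diff subspace_scale)
  have uw: "u \<bullet> w = 0" by (simp add: w_def inner_diff_right uu c_def)
  have Au: "A *v u = w + c *\<^sub>R u" by (simp add: w_def)
  \<comment> \<open>Homogeneity carries the maximality of \<open>c\<close> from the unit sphere to
    all of \<open>S\<close>.\<close>
  have quad: "x \<bullet> (A *v x) \<le> c * (x \<bullet> x)" if "x \<in> S" for x
  proof (cases "x = 0")
    case False
    let ?y = "(1 / norm x) *\<^sub>R x"
    have "?y \<in> K" using False that S(1) by (simp add: K_def subspace_scale)
    from mx[OF this] have "(x \<bullet> (A *v x)) / (norm x)\<^sup>2 \<le> c"
      by (simp add: c_def matrix_vector_mult_scaleR power2_eq_square)
    then show ?thesis using False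
      by (simp add: divide_le_eq power2_norm_eq_inner)
  qed simp
  have "w = 0"
  proof (rule ccontr)
    assume "w \<noteq> 0"
    then have pos: "w \<bullet> w > 0" by simp
    define d where "d = c * (w \<bullet> w) - w \<bullet> (A *v w)"
    \<comment> \<open>Apply \<open>quad\<close> at \<open>u + t *\<^sub>R w\<close>: the constant
      terms cancel, the first-order term is \<open>2 * t * (w \<bullet> w)\<close>, and everything
      else is quadratic in \<open>t\<close>. One factor \<open>t\<close> is then cancelled.\<close>
    have key: "2 * (w \<bullet> w) \<le> t * d" if "t > 0" for t
    proof -
      let ?x = "u + t *\<^sub>R w"
      have "?x \<in> S" using uS wS S(1) by (simp add: subspace_add subspace_scale)
      note q = quad[OF this]
      have uAw: "u \<bullet> (A *v w) = w \<bullet> w"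
        using symmetric_mat_inner_commute[OF sym, of u w] uw by (simp add: Au inner_add_left)
      have wAu: "w \<bullet> (A *v u) = w \<bullet> w" using uw by (simp add: Au inner_add_right inner_commute)
      have "?x \<bullet> (A *v ?x) = c + 2 * t * (w \<bullet> w) + t\<^sup>2 * (w \<bullet> (A *v w))"
        by (simp add: matrix_vector_right_distrib matrix_vector_mult_scaleR inner_add_left
            inner_add_right uAw wAu c_def[symmetric] power2_eq_square algebra_simps)
      moreover have "?x \<bullet> ?x = 1 + t\<^sup>2 * (w \<bullet> w)"
        using uw by (simp add: inner_add_left inner_add_right uu inner_commute power2_eq_square)
      ultimately have "t * (2 * (w \<bullet> w)) \<le> t * (t * d)"
        using q unfolding d_def by (simp only:) (simp add: power2_eq_square algebra_simps)
      then show ?thesis using that by simp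
    qed
    have dpos: "d > 0" using key[of 1] pos by linarith
    \<comment> \<open>This \<open>t\<close> turns the bound into
      \<open>2 * (w \<bullet> w) \<le> w \<bullet> w\<close>.\<close>
    from key[of "(w \<bullet> w) / d"] dpos pos show False by simp
  qed
  then have "A *v u = c *\<^sub>R u" using Au by simp
  then show ?thesis using that uS nu by blast
qed

text \<open>Induction on \<open>dim S\<close>: split off one unit eigenvector \<open>u\<close> and
  pass to its orthogonal complement in \<open>S\<close>, which is again invariant because
  \<open>A\<close> is symmetric.\<close>

lemma symmetric_mat_orthonormal_eigenvectors_span:
  fixes A :: "real^'n^'n"
  assumes sym: "symmetric_mat A"
  shows "subspace S \<Longrightarrow> (\<And>x. x \<in> S \<Longrightarrow> A *v x \<in> S) \<Longrightarrow>
    \<exists>B. B \<subseteq> S \<and> pairwise orthogonal B \<and> (\<forall>u\<in>B. norm u = 1 \<and> (\<exists>c. A *v u = c *\<^sub>R u)) \<and> span B = S"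
proof (induction "dim S" arbitrary: S rule: less_induct)
  case less
  show ?case
  proof (cases "S = {0}")
    case True
    then show ?thesis by (intro exI[of _ "{}"]) auto
  next
    case False
    obtain u c where u: "u \<in> S" "norm u = 1" "A *v u = c *\<^sub>R u"
      using symmetric_mat_eigenvector_exists[OF sym less.prems(1) False less.prems(2)] by blast
    have uu: "u \<bullet> u = 1" using u(2) by (simp add: norm_eq_1)
    define S' where "S' = S \<inter> {x. u \<bullet> x = 0}"
    have sub: "subspace S'" unfolding S'_def
      by (intro subspace_inter less.prems(1) subspace_hyperplane)
    have inv: "A *v x \<in> S'" if "x \<in> S'" for x
      using that less.prems(2) u(3) symmetric_mat_inner_commute[OF sym, of u x]
      by (simp add: S'_def)
    have "u \<notin> S'" using uu by (simp add: S'_def)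
    then have "S' \<subset> S" using u(1) unfolding S'_def by blast
    then have "dim S' < dim S"
      by (intro dim_psubset) (simp add: span_eq_iff[THEN iffD2] sub less.prems(1))
    from less.hyps[OF this sub inv] obtain B where B: "B \<subseteq> S'" "pairwise orthogonal B"
      "\<forall>u\<in>B. norm u = 1 \<and> (\<exists>c. A *v u = c *\<^sub>R u)" "span B = S'" by blast
    have "pairwise orthogonal (insert u B)"
      using B(1,2) by (auto simp: pairwise_insert S'_def orthogonal_def inner_commute)
    moreover have "insert u B \<subseteq> S" using B(1) u(1) by (auto simp: S'_def)
    moreover have "span (insert u B) = S"
    proof
      show "span (insert u B) \<subseteq> S"
        using \<open>insert u B \<subseteq> S\<close> less.prems(1) by (simp add: span_minimal)
      show "S \<subseteq> span (insert u B)"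
      proof
        fix x assume x: "x \<in> S"
        have "x - (u \<bullet> x) *\<^sub>R u \<in> S'"
          using x u(1) less.prems(1) uu
          by (simp add: S'_def subspace_diff subspace_scale inner_diff_right)
        then show "x \<in> span (insert u B)" using B(4) by (auto simp: span_insert)
      qed
    qed
    ultimately show ?thesis using B(3) u by (intro exI[of _ "insert u B"]) auto
  qed
qed

text \<open>Indexing by the dimension type \<open>'n\<close> itself makes any such family a basis,
  so spanning is not part of the definition.\<close>

definition orthonormal_basis :: "('n \<Rightarrow> real^'n) \<Rightarrow> bool" where
  "orthonormal_basis u \<longleftrightarrow> (\<forall>i j. u i \<bullet> u j = (if i = j then 1 else 0))"

definition eigenbasis :: "real^'n^'n \<Rightarrow> ('n \<Rightarrow> real^'n) \<Rightarrow> ('n \<Rightarrow> real) \<Rightarrow> bool" where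
  "eigenbasis A u a \<longleftrightarrow> orthonormal_basis u \<and> (\<forall>i. A *v u i = a i *\<^sub>R u i)"

theorem symmetric_mat_eigenbasis_exists:
  fixes A :: "real^'n^'n"
  assumes "symmetric_mat A"
  obtains u a where "eigenbasis A u a"
proof -
  obtain B where B: "pairwise orthogonal B"
      "\<forall>u\<in>B. norm u = 1 \<and> (\<exists>c. A *v u = c *\<^sub>R u)" "span B = UNIV"
    using symmetric_mat_orthonormal_eigenvectors_span[OF assms subspace_UNIV] by auto
  have "0 \<notin> B" using B(2) by force
  then have ind: "independent B" using B(1) by (simp add: pairwise_orthogonal_independent)
  then have "card B = CARD('n)"
    using B(3) by (metis dim_UNIV dim_eq_card_independent dim_span DIM_cart DIM_real mult.right_neutral)
  \<comment> \<open>\<open>B\<close> has as many elements as the index type, so it can be relabelled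
    by \<open>'n\<close>.\<close>
  then obtain u where u: "bij_betw u (UNIV :: 'n set) B"
    using finite_same_card_bij[OF finite finiteI_independent[OF ind], of "UNIV :: 'n set"] by auto
  have uB: "u i \<in> B" for i using u by (auto simp: bij_betw_def)
  have "u i \<bullet> u j = (if i = j then 1 else 0)" for i j
  proof (cases "i = j")
    case True
    then show ?thesis using B(2) uB by (simp add: norm_eq_1[symmetric])
  next
    case False
    then have "u i \<noteq> u j" using u by (auto simp: bij_betw_def inj_def)
    then show ?thesis using False B(1) uB by (auto simp: pairwise_def orthogonal_def)
  qed
  then have "orthonormal_basis u" by (simp add: orthonormal_basis_def)
  moreover have "\<forall>i. \<exists>c. A *v u i = c *\<^sub>R u i" using B(2) uB by blast
  then obtain a where "\<forall>i. A *v u i = a i *\<^sub>R u i" unfolding choice_iff by blast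
  ultimately show ?thesis using that by (auto simp: eigenbasis_def)
qed

section \<open>Coordinates and traces in an orthonormal basis\<close>

context
  fixes u :: "'n::finite \<Rightarrow> real^'n"
  assumes onb: "orthonormal_basis u"
begin

text \<open>A one-sided inverse of a square matrix is two-sided: orthonormal rows of
  \<open>Q\<close> force orthonormal columns.\<close>

lemma orthonormal_basis_completeness:
  "(\<Sum>i\<in>UNIV. u i $ p * u i $ q) = (if p = q then 1 else 0)"
proof -
  define Q :: "real^'n^'n" where "Q = (\<chi> i. u i)"
  have "Q ** transpose Q = mat 1"
    using onb by (simp add: Q_def matrix_matrix_mult_def transpose_def mat_def vec_eq_iff
        orthonormal_basis_def inner_vec_def)
  then have "transpose Q ** Q = mat 1" by (simp add: matrix_left_right_inverse)
  then show ?thesis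
    by (simp add: Q_def matrix_matrix_mult_def transpose_def mat_def vec_eq_iff)
qed

lemma orthonormal_basis_parseval: "x \<bullet> y = (\<Sum>i\<in>UNIV. (u i \<bullet> x) * (u i \<bullet> y))"
proof -
  have "(\<Sum>i\<in>UNIV. (u i \<bullet> x) * (u i \<bullet> y)) =
      (\<Sum>i\<in>UNIV. \<Sum>p\<in>UNIV. \<Sum>q\<in>UNIV. (u i $ p * u i $ q) * (x $ p * y $ q))"
    by (simp add: inner_vec_def sum_product mult.assoc mult.left_commute)
  also have "\<dots> = (\<Sum>p\<in>UNIV. \<Sum>q\<in>UNIV. \<Sum>i\<in>UNIV. (u i $ p * u i $ q) * (x $ p * y $ q))"
    by (subst sum.swap, rule sum.cong[OF refl], rule sum.swap)
  also have "\<dots> = (\<Sum>p\<in>UNIV. \<Sum>q\<in>UNIV. (if p = q then 1 else 0) * (x $ p * y $ q))"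
    by (simp add: sum_distrib_right[symmetric] orthonormal_basis_completeness)
  also have "\<dots> = x \<bullet> y" by (simp add: inner_vec_def if_distrib[of "\<lambda>z. z * _"] cong: if_cong)
  finally show ?thesis by simp
qed

lemma trace_eq_sum_orthonormal_basis: "trace M = (\<Sum>i\<in>UNIV. u i \<bullet> (M *v u i))"
proof -
  have "(\<Sum>i\<in>UNIV. u i \<bullet> (M *v u i)) =
      (\<Sum>i\<in>UNIV. \<Sum>p\<in>UNIV. \<Sum>q\<in>UNIV. (u i $ p * u i $ q) * M $ p $ q)"
    by (simp add: inner_vec_def matrix_vector_mult_def sum_distrib_left mult_ac)
  also have "\<dots> = (\<Sum>p\<in>UNIV. \<Sum>q\<in>UNIV. \<Sum>i\<in>UNIV. (u i $ p * u i $ q) * M $ p $ q)"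
    by (subst sum.swap, rule sum.cong[OF refl], rule sum.swap)
  also have "\<dots> = (\<Sum>p\<in>UNIV. \<Sum>q\<in>UNIV. (if p = q then 1 else 0) * M $ p $ q)"
    by (simp add: sum_distrib_right[symmetric] orthonormal_basis_completeness)
  also have "\<dots> = trace M" by (simp add: trace_def if_distrib[of "\<lambda>z. z * _"] cong: if_cong)
  finally show ?thesis by simp
qed

lemma orthonormal_basis_norm: "norm (u i) = 1"
  using onb by (simp add: orthonormal_basis_def norm_eq_1)

lemma orthonormal_basis_sum_inner_squared: "(\<Sum>i\<in>UNIV. (u i \<bullet> x)\<^sup>2) = (norm x)\<^sup>2"
  unfolding power2_norm_eq_inner orthonormal_basis_parseval[of x x] by (simp add: power2_eq_square)

text \<open>Each row of \<open>A - B\<close> is orthogonal to every basis vector, hence zero by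
  Parseval. This is how powers of a matrix are identified from their eigenvectors.\<close>

lemma orthonormal_basis_mat_ext:
  assumes "\<And>i. A *v u i = B *v u i"
  shows "A = B"
proof -
  have row: "A $ p = B $ p" for p
  proof -
    have "(u i \<bullet> (A $ p - B $ p)) = 0" for i
      using arg_cong[OF assms[of i], of "\<lambda>v. v $ p"]
      by (simp add: matrix_vector_mul_component inner_diff_right inner_commute)
    then have "(A $ p - B $ p) \<bullet> (A $ p - B $ p) = 0"
      by (subst orthonormal_basis_parseval) simp
    then show ?thesis by simp
  qed
  then show ?thesis by (simp add: vec_eq_iff)
qed

end

section \<open>Spectral form of a matrix and its exponential\<close>

text \<open>For orthonormal \<open>u\<close> this is the combination of the rank-one projections
  onto the \<open>u i\<close> with coefficients \<open>f i\<close>. The entrywise form lets limits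
  be taken entry by entry.\<close>

definition spectral_mat :: "('n::finite \<Rightarrow> real^'n) \<Rightarrow> ('n \<Rightarrow> real) \<Rightarrow> real^'n^'n" where
  "spectral_mat u f = (\<chi> p q. \<Sum>i\<in>UNIV. f i * (u i $ p * u i $ q))"

lemma symmetric_mat_spectral_mat: "symmetric_mat (spectral_mat u f)"
  by (simp add: symmetric_mat_def spectral_mat_def transpose_def vec_eq_iff mult.commute)

lemma spectral_mat_mult_vec: "spectral_mat u f *v x = (\<Sum>i\<in>UNIV. (f i * (u i \<bullet> x)) *\<^sub>R u i)"
proof -
  have "(spectral_mat u f *v x) $ p = (\<Sum>i\<in>UNIV. (f i * (u i \<bullet> x)) *\<^sub>R u i) $ p" for p
  proof -
    have "(spectral_mat u f *v x) $ p = (\<Sum>q\<in>UNIV. \<Sum>i\<in>UNIV. f i * (u i $ p * u i $ q) * x $ q)"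
      by (simp add: spectral_mat_def matrix_vector_mult_def sum_distrib_right)
    also have "\<dots> = (\<Sum>i\<in>UNIV. \<Sum>q\<in>UNIV. f i * (u i $ p * u i $ q) * x $ q)"
      by (rule sum.swap)
    also have "\<dots> = (\<Sum>i\<in>UNIV. (f i * (u i \<bullet> x)) *\<^sub>R u i) $ p"
      by (simp add: inner_vec_def sum_distrib_left sum_distrib_right mult_ac)
    finally show ?thesis .
  qed
  then show ?thesis by (simp add: vec_eq_iff)
qed

lemma inner_spectral_mat: "x \<bullet> (spectral_mat u f *v x) = (\<Sum>i\<in>UNIV. f i * (u i \<bullet> x)\<^sup>2)"
  by (simp add: spectral_mat_mult_vec inner_sum_right power2_eq_square inner_commute mult_ac)

lemma spectral_mat_eigenbasis:
  assumes "orthonormal_basis u"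
  shows "eigenbasis (spectral_mat u f) u f"
proof -
  have "spectral_mat u f *v u j = f j *\<^sub>R u j" for j
  proof -
    have "spectral_mat u f *v u j = (\<Sum>i\<in>UNIV. if i = j then f i *\<^sub>R u i else 0)"
      unfolding spectral_mat_mult_vec using assms
      by (intro sum.cong) (auto simp: orthonormal_basis_def)
    then show ?thesis by simp
  qed
  with assms show ?thesis by (simp add: eigenbasis_def)
qed

lemma eigenbasis_unique_mat:
  assumes "eigenbasis A u a" "eigenbasis B u a"
  shows "A = B"
  using assms orthonormal_basis_mat_ext[of u A B] by (simp add: eigenbasis_def)

lemma eigenbasis_mat_power:
  assumes "eigenbasis A u a"
  shows "eigenbasis (mat_power A k) u (\<lambda>i. a i ^ k)"
proof -
  have "mat_power A k *v u i = (a i ^ k) *\<^sub>R u i" for i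
    using assms
    by (induction k) (simp_all add: mat_power_def eigenbasis_def matrix_vector_mul_assoc[symmetric]
        matrix_vector_mult_scaleR mult.commute)
  with assms show ?thesis by (simp add: eigenbasis_def)
qed

text \<open>All powers of \<open>A\<close> share its eigenbasis, so each entry of the matrix series
  is a finite combination of scalar exponential series.\<close>

lemma mat_exp_eq_spectral_mat:
  assumes "eigenbasis A u a"
  shows "mat_exp A = spectral_mat u (\<lambda>i. exp (a i))"
proof -
  have onb: "orthonormal_basis u" using assms by (simp add: eigenbasis_def)
  have pow: "mat_power A k = spectral_mat u (\<lambda>i. a i ^ k)" for k
    using eigenbasis_unique_mat[OF eigenbasis_mat_power[OF assms] spectral_mat_eigenbasis[OF onb]] .
  have "(\<lambda>k. \<Sum>i\<in>UNIV. ((1 / fact k) * a i ^ k) * (u i $ p * u i $ q)) sums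
      (\<Sum>i\<in>UNIV. exp (a i) * (u i $ p * u i $ q))" for p q
  proof (intro sums_sum sums_mult2)
    fix i
    show "(\<lambda>k. (1 / fact k) * a i ^ k) sums exp (a i)"
      using exp_converges[of "a i"] by (simp add: divide_inverse)
  qed
  then have "(\<lambda>k. (1 / fact k) *\<^sub>R mat_power A k) sums spectral_mat u (\<lambda>i. exp (a i))"
    unfolding sums_def pow spectral_mat_def
    by (intro vec_tendstoI) (simp add: sum_distrib_left mult.assoc)
  then show ?thesis unfolding mat_exp_def by (rule sums_unique[symmetric])
qed

lemma trace_eigenbasis:
  assumes "eigenbasis A u a"
  shows "trace A = (\<Sum>i\<in>UNIV. a i)"
  using assms
  by (simp add: eigenbasis_def trace_eq_sum_orthonormal_basis[of u] orthonormal_basis_def)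

lemma trace_mult_eigenbasis:
  assumes "eigenbasis A u a"
  shows "trace (M ** A) = (\<Sum>i\<in>UNIV. a i * (u i \<bullet> (M *v u i)))"
  using assms
  by (simp add: eigenbasis_def trace_eq_sum_orthonormal_basis[of u] matrix_vector_mul_assoc[symmetric]
      matrix_vector_mult_scaleR)

section \<open>Partition function and Gibbs states\<close>

definition partition_function :: "real^'n^'n \<Rightarrow> real" where
  "partition_function H = trace (mat_exp (- H))"

lemma eigenbasis_uminus: "eigenbasis A u a \<Longrightarrow> eigenbasis (- A) u (\<lambda>i. - a i)"
  using matrix_vector_mult_diff_rdistrib[of 0 A] by (simp add: eigenbasis_def)

lemma partition_function_eigenbasis:
  assumes "eigenbasis (- H) u a"
  shows "partition_function H = (\<Sum>i\<in>UNIV. exp (a i))"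
  unfolding partition_function_def mat_exp_eq_spectral_mat[OF assms]
  using assms by (intro trace_eigenbasis[OF spectral_mat_eigenbasis]) (simp add: eigenbasis_def)

lemma symmetric_mat_uminus: "symmetric_mat A \<Longrightarrow> symmetric_mat (- A)"
  by (simp add: symmetric_mat_def transpose_def vec_eq_iff)

lemma symmetric_mat_add_scaleR:
  "symmetric_mat A \<Longrightarrow> symmetric_mat B \<Longrightarrow> symmetric_mat (A + c *\<^sub>R B)"
  by (simp add: symmetric_mat_def transpose_def vec_eq_iff)

lemma partition_function_pos:
  fixes H :: "real^'n^'n"
  assumes "symmetric_mat H"
  shows "partition_function H > 0"
proof -
  obtain u a where "eigenbasis (- H) u a"
    using symmetric_mat_eigenbasis_exists[OF symmetric_mat_uminus[OF assms]] .
  from partition_function_eigenbasis[OF this] show ?thesis by (simp add: sum_pos)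
qed

lemma gibbs_state_eq_spectral_mat:
  assumes "eigenbasis (- H) u a"
  shows "gibbs_state H = spectral_mat u (\<lambda>i. exp (a i) / partition_function H)"
proof -
  have "gibbs_state H = (1 / partition_function H) *\<^sub>R mat_exp (- H)"
    by (simp only: gibbs_state_def partition_function_def)
  then show ?thesis unfolding mat_exp_eq_spectral_mat[OF assms]
    by (simp add: spectral_mat_def vec_eq_iff sum_divide_distrib)
qed

lemma trace_mult_gibbs_state:
  assumes "eigenbasis (- H) u a"
  shows "trace (M ** gibbs_state H)
    = (\<Sum>i\<in>UNIV. exp (a i) * (u i \<bullet> (M *v u i))) / partition_function H"
proof -
  have "orthonormal_basis u" using assms by (simp add: eigenbasis_def)
  from trace_mult_eigenbasis[OF spectral_mat_eigenbasis[OF this]] show ?thesis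
    by (simp add: gibbs_state_eq_spectral_mat[OF assms] sum_divide_distrib)
qed

lemma gibbs_state_in_quantum_states:
  fixes H :: "real^'n^'n"
  assumes "symmetric_mat H"
  shows "gibbs_state H \<in> quantum_states"
proof -
  obtain u a where e: "eigenbasis (- H) u a"
    using symmetric_mat_eigenbasis_exists[OF symmetric_mat_uminus[OF assms]] .
  then have "orthonormal_basis u" by (simp add: eigenbasis_def)
  note tr = trace_eigenbasis[OF spectral_mat_eigenbasis[OF this]]
  have pos: "partition_function H > 0" by (rule partition_function_pos[OF assms])
  have "trace (gibbs_state H) = 1"
    using pos unfolding gibbs_state_eq_spectral_mat[OF e] tr
    by (simp add: sum_divide_distrib[symmetric] partition_function_eigenbasis[OF e])
  moreover have "psd (gibbs_state H)"
    using pos unfolding psd_def gibbs_state_eq_spectral_mat[OF e]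
    by (auto simp: symmetric_mat_spectral_mat inner_spectral_mat intro!: sum_nonneg)
  ultimately show ?thesis by (simp add: quantum_states_def)
qed

text \<open>The starting state of the algorithm is the Gibbs state of \<open>H = 0\<close>, so the
  invariant of the loop holds from the beginning; the initial potential is the logarithm of the
  dimension.\<close>

lemma gibbs_state_0: "gibbs_state (0 :: real^'n^'n) = (1 / real CARD('n)) *\<^sub>R mat 1"
  and partition_function_0: "partition_function (0 :: real^'n^'n) = real CARD('n)"
proof -
  have onb: "orthonormal_basis (\<lambda>i::'n. axis i (1::real))"
    by (simp add: orthonormal_basis_def inner_axis_axis)
  then have "eigenbasis (- 0 :: real^'n^'n) (\<lambda>i. axis i 1) (\<lambda>i. 0)"
    by (simp add: eigenbasis_def)
  note e = mat_exp_eq_spectral_mat[OF this]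
  have "eigenbasis (mat 1 :: real^'n^'n) (\<lambda>i. axis i 1) (\<lambda>i. exp 0)"
    using onb by (simp add: eigenbasis_def)
  from eigenbasis_unique_mat[OF this spectral_mat_eigenbasis[OF onb]] e
  have m: "mat_exp (- 0 :: real^'n^'n) = mat 1" by simp
  show "gibbs_state (0 :: real^'n^'n) = (1 / real CARD('n)) *\<^sub>R mat 1"
    and "partition_function (0 :: real^'n^'n) = real CARD('n)"
    unfolding gibbs_state_def partition_function_def m by (simp_all add: trace_I)
qed

section \<open>Trace bounds against quantum states\<close>

lemma norm_mult_vec_le_of_operator_norm:
  assumes "operator_norm P \<le> 1"
  shows "norm (P *v x) \<le> norm x"
proof -
  have "norm (P *v x) \<le> onorm ((*v) P) * norm x"
    by (rule onorm) (rule matrix_vector_mul_bounded_linear)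
  also have "\<dots> \<le> 1 * norm x"
    using assms unfolding operator_norm_def by (rule mult_right_mono) simp
  finally show ?thesis by simp
qed

text \<open>The diagonal of a state in an orthonormal basis is a probability distribution, so
  \<open>trace (M ** Y)\<close> is an average of the eigenvalues of a symmetric
  \<open>M\<close>.\<close>

lemma quantum_state_diagonal:
  assumes "Y \<in> quantum_states" "orthonormal_basis u"
  shows "u i \<bullet> (Y *v u i) \<ge> 0" "(\<Sum>i\<in>UNIV. u i \<bullet> (Y *v u i)) = 1"
  using assms trace_eq_sum_orthonormal_basis[of u Y]
  by (auto simp: quantum_states_def psd_def)

lemma abs_trace_mult_quantum_state_le:
  fixes P :: "real^'n^'n"
  assumes Y: "Y \<in> quantum_states" and P: "symmetric_mat P" "operator_norm P \<le> 1"
  shows "\<bar>trace (P ** Y)\<bar> \<le> 1"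
proof -
  obtain u p where e: "eigenbasis P u p" using symmetric_mat_eigenbasis_exists[OF P(1)] .
  then have onb: "orthonormal_basis u" by (simp add: eigenbasis_def)
  have p: "\<bar>p i\<bar> \<le> 1" for i
    using norm_mult_vec_le_of_operator_norm[OF P(2), of "u i"] e orthonormal_basis_norm[OF onb]
    by (simp add: eigenbasis_def)
  have "trace (P ** Y) = (\<Sum>i\<in>UNIV. p i * (u i \<bullet> (Y *v u i)))"
    using trace_mult_eigenbasis[OF e, of Y] unfolding trace_mul_sym[of Y P] .
  then have "\<bar>trace (P ** Y)\<bar> \<le> (\<Sum>i\<in>UNIV. \<bar>p i * (u i \<bullet> (Y *v u i))\<bar>)" by simp
  also have "\<dots> \<le> (\<Sum>i\<in>UNIV. u i \<bullet> (Y *v u i))"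
    using p quantum_state_diagonal(1)[OF Y onb]
    by (intro sum_mono) (simp add: abs_mult mult_left_le_one_le)
  also have "\<dots> = 1" by (rule quantum_state_diagonal(2)[OF Y onb])
  finally show ?thesis .
qed

text \<open>Nonnegativity of the potential: the left side averages the numbers \<open>- h i\<close>,
  and each is at most the logarithm of the sum of their exponentials.\<close>

lemma neg_trace_mult_le_ln_partition_function:
  fixes H :: "real^'n^'n"
  assumes H: "symmetric_mat H" and Y: "Y \<in> quantum_states"
  shows "- trace (H ** Y) \<le> ln (partition_function H)"
proof -
  obtain u h where e: "eigenbasis H u h" using symmetric_mat_eigenbasis_exists[OF H] .
  then have onb: "orthonormal_basis u" by (simp add: eigenbasis_def)
  have Z: "partition_function H = (\<Sum>i\<in>UNIV. exp (- h i))"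
    using partition_function_eigenbasis[OF eigenbasis_uminus[OF e]] .
  have h: "- h i \<le> ln (partition_function H)" for i
  proof -
    have "exp (- h i) \<le> partition_function H"
      unfolding Z by (rule member_le_sum) auto
    then show ?thesis using partition_function_pos[OF H] by (simp add: ln_ge_iff)
  qed
  have "- trace (H ** Y) = (\<Sum>i\<in>UNIV. - h i * (u i \<bullet> (Y *v u i)))"
    using trace_mult_eigenbasis[OF e, of Y] unfolding trace_mul_sym[of Y H] by (simp add: sum_negf)
  also have "\<dots> \<le> (\<Sum>i\<in>UNIV. ln (partition_function H) * (u i \<bullet> (Y *v u i)))"
    using h quantum_state_diagonal(1)[OF Y onb] by (intro sum_mono mult_right_mono)
  also have "\<dots> = ln (partition_function H)"
    by (simp add: sum_distrib_left[symmetric] quantum_state_diagonal(2)[OF Y onb])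
  finally show ?thesis .
qed

section \<open>Decrease of the potential in one update\<close>

text \<open>The tangent at \<open>b\<close> bounds the remainder by
  \<open>(b - a) * (exp b - exp a)\<close>; the tangent at the larger of the two points bounds that
  product. The factor \<open>exp a + exp b\<close> dominates both cases and splits into one term for
  each eigenbasis.\<close>

lemma exp_taylor_remainder_le:
  fixes a b :: real
  shows "exp b - exp a - exp a * (b - a) \<le> (b - a)\<^sup>2 * (exp a + exp b)"
proof -
  have tangent: "exp y - exp x \<le> (y - x) * exp y" for x y :: real
  proof -
    have "(1 + (x - y)) * exp y \<le> exp (x - y) * exp y"
      by (intro mult_right_mono exp_ge_add_one_self) simp
    then show ?thesis by (simp add: exp_diff algebra_simps)
  qed
  have "(b - a) * (exp b - exp a) \<le> (b - a)\<^sup>2 * (exp a + exp b)"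
  proof (cases "a \<le> b")
    case True
    have "(b - a) * (exp b - exp a) \<le> (b - a) * ((b - a) * exp b)"
      using True tangent by (intro mult_left_mono) auto
    also have "\<dots> \<le> (b - a)\<^sup>2 * (exp a + exp b)" by (simp add: power2_eq_square distrib_left)
    finally show ?thesis .
  next
    case False
    have "(a - b) * (exp a - exp b) \<le> (a - b) * ((a - b) * exp a)"
      using False tangent by (intro mult_left_mono) auto
    also have "\<dots> \<le> (a - b)\<^sup>2 * (exp a + exp b)" by (simp add: power2_eq_square distrib_left)
    finally show ?thesis by (simp add: power2_commute algebra_simps)
  qed
  then show ?thesis using tangent[of b a] by (simp add: algebra_simps)
qed

text \<open>The remainder contributes \<eta> squared times both partition functions; moving the
  share of the new one to the left produces the factor \<open>1 - \<eta>\<^sup>2\<close>.\<close>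

lemma partition_function_update_le:
  fixes H P :: "real^'n^'n"
  assumes H: "symmetric_mat H" and P: "symmetric_mat P" "operator_norm P \<le> 1"
  shows "partition_function (H + \<eta> *\<^sub>R P) * (1 - \<eta>\<^sup>2)
    \<le> partition_function H * (1 + \<eta>\<^sup>2 - \<eta> * trace (P ** gibbs_state H))"
proof -
  define H' where "H' = H + \<eta> *\<^sub>R P"
  have H': "symmetric_mat H'" unfolding H'_def using H P(1) by (rule symmetric_mat_add_scaleR)
  obtain u a where e: "eigenbasis (- H) u a"
    using symmetric_mat_eigenbasis_exists[OF symmetric_mat_uminus[OF H]] .
  obtain v b where e': "eigenbasis (- H') v b"
    using symmetric_mat_eigenbasis_exists[OF symmetric_mat_uminus[OF H']] .
  have u: "orthonormal_basis u" and v: "orthonormal_basis v"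
    using e e' by (simp_all add: eigenbasis_def)
  let ?Z = "partition_function H" and ?Z' = "partition_function H'"
  note Z = partition_function_eigenbasis[OF e] and Z' = partition_function_eigenbasis[OF e']
  define w where "w i j = (u i \<bullet> v j)\<^sup>2" for i j
  have wpos: "w i j \<ge> 0" for i j by (simp add: w_def)
  have wrow: "(\<Sum>j\<in>UNIV. w i j) = 1" for i
    using orthonormal_basis_sum_inner_squared[OF v, of "u i"] orthonormal_basis_norm[OF u]
    by (simp add: w_def inner_commute)
  have wcol: "(\<Sum>i\<in>UNIV. w i j) = 1" for j
    using orthonormal_basis_sum_inner_squared[OF u, of "v j"] orthonormal_basis_norm[OF v]
    by (simp add: w_def)
  \<comment> \<open>Evaluate the form of \<open>- H'\<close> between \<open>u i\<close> and
    \<open>v j\<close>: \<open>- H'\<close> acts on \<open>v j\<close> as \<open>b j\<close>, while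
    its summand \<open>- H\<close>, moved to the other side by symmetry, acts on \<open>u i\<close>
    as \<open>a i\<close>.\<close>
  have diff: "(b j - a i) * (u i \<bullet> v j) = - \<eta> * (u i \<bullet> (P *v v j))" for i j
  proof -
    have "(- H') *v v j = (- H) *v v j - \<eta> *\<^sub>R (P *v v j)"
      by (simp add: H'_def matrix_vector_mult_def vec_eq_iff sum_distrib_left
          sum_subtractf[symmetric] algebra_simps)
    then have "b j * (u i \<bullet> v j) = u i \<bullet> ((- H) *v v j) - \<eta> * (u i \<bullet> (P *v v j))"
      using e' by (simp add: eigenbasis_def inner_diff_right[symmetric] flip: inner_scaleR_right)
    also have "u i \<bullet> ((- H) *v v j) = a i * (u i \<bullet> v j)"
      using symmetric_mat_inner_commute[OF symmetric_mat_uminus[OF H], of "u i" "v j"] e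
      by (simp add: eigenbasis_def)
    finally show ?thesis by (simp add: algebra_simps)
  qed
  have Pcomm: "u i \<bullet> (P *v v j) = v j \<bullet> (P *v u i)" for i j
    using symmetric_mat_inner_commute[OF P(1), of "u i" "v j"] by (simp add: inner_commute)
  \<comment> \<open>One factor \<open>u i \<bullet> v j\<close> of the weight is absorbed by
    \<open>diff\<close>; the other supplies the coordinates for Parseval in the basis
    \<open>v\<close>.\<close>
  have lin: "(\<Sum>j\<in>UNIV. w i j * (b j - a i)) = - \<eta> * (u i \<bullet> (P *v u i))" for i
  proof -
    have "(\<Sum>j\<in>UNIV. w i j * (b j - a i)) = (\<Sum>j\<in>UNIV. (u i \<bullet> v j) * ((b j - a i) * (u i \<bullet> v j)))"
      by (simp add: w_def power2_eq_square mult_ac)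
    also have "\<dots> = - \<eta> * (\<Sum>j\<in>UNIV. (v j \<bullet> u i) * (v j \<bullet> (P *v u i)))"
      unfolding diff by (simp add: Pcomm sum_distrib_left inner_commute[of "u i"] mult_ac)
    also have "\<dots> = - \<eta> * (u i \<bullet> (P *v u i))"
      by (simp only: orthonormal_basis_parseval[OF v, symmetric])
    finally show ?thesis .
  qed
  have sq: "w i j * (b j - a i)\<^sup>2 = \<eta>\<^sup>2 * (u i \<bullet> (P *v v j))\<^sup>2" for i j
    using arg_cong[OF diff[of j i], of "\<lambda>x. x\<^sup>2"] by (simp add: w_def power_mult_distrib mult.commute)
  have nP: "(norm (P *v x))\<^sup>2 \<le> 1" if "norm x = 1" for x
    using norm_mult_vec_le_of_operator_norm[OF P(2), of x] that by (simp add: power_le_one)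
  \<comment> \<open>Here both factors of the weight are absorbed, leaving the squared coordinates of
    \<open>P *v u i\<close> in the basis \<open>v\<close>. \<open>sqcol\<close> is the same with the
    two bases exchanged.\<close>
  have sqrow: "(\<Sum>j\<in>UNIV. w i j * (b j - a i)\<^sup>2) \<le> \<eta>\<^sup>2" for i
  proof -
    have "(\<Sum>j\<in>UNIV. w i j * (b j - a i)\<^sup>2) = \<eta>\<^sup>2 * (norm (P *v u i))\<^sup>2"
      unfolding sq Pcomm by (simp only: sum_distrib_left[symmetric] orthonormal_basis_sum_inner_squared[OF v])
    then show ?thesis using nP[OF orthonormal_basis_norm[OF u]] by (simp add: mult_left_le)
  qed
  have sqcol: "(\<Sum>i\<in>UNIV. w i j * (b j - a i)\<^sup>2) \<le> \<eta>\<^sup>2" for j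
  proof -
    have "(\<Sum>i\<in>UNIV. w i j * (b j - a i)\<^sup>2) = \<eta>\<^sup>2 * (norm (P *v v j))\<^sup>2"
      unfolding sq by (simp only: sum_distrib_left[symmetric] orthonormal_basis_sum_inner_squared[OF u])
    then show ?thesis using nP[OF orthonormal_basis_norm[OF v]] by (simp add: mult_left_le)
  qed
  have "(\<Sum>i\<in>UNIV. \<Sum>j\<in>UNIV. w i j * (exp (b j) - exp (a i) - exp (a i) * (b j - a i)))
      = (\<Sum>i\<in>UNIV. \<Sum>j\<in>UNIV. w i j * exp (b j)) - (\<Sum>i\<in>UNIV. \<Sum>j\<in>UNIV. exp (a i) * w i j)
        - (\<Sum>i\<in>UNIV. \<Sum>j\<in>UNIV. exp (a i) * (w i j * (b j - a i)))"
    by (simp add: sum_subtractf[symmetric] right_diff_distrib mult_ac)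
  also have "(\<Sum>i\<in>UNIV. \<Sum>j\<in>UNIV. w i j * exp (b j)) = ?Z'"
    by (subst sum.swap) (simp add: sum_distrib_right[symmetric] wcol Z')
  also have "(\<Sum>i\<in>UNIV. \<Sum>j\<in>UNIV. exp (a i) * w i j) = ?Z"
    by (simp add: sum_distrib_left[symmetric] wrow Z)
  also have "(\<Sum>i\<in>UNIV. \<Sum>j\<in>UNIV. exp (a i) * (w i j * (b j - a i)))
      = - \<eta> * (\<Sum>i\<in>UNIV. exp (a i) * (u i \<bullet> (P *v u i)))"
    by (simp only: sum_distrib_left[symmetric] lin) (simp add: sum_distrib_left mult_ac)
  also have "(\<Sum>i\<in>UNIV. exp (a i) * (u i \<bullet> (P *v u i))) = ?Z * trace (P ** gibbs_state H)"
    using partition_function_pos[OF H] by (simp add: trace_mult_gibbs_state[OF e])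
  finally have lhs: "(\<Sum>i\<in>UNIV. \<Sum>j\<in>UNIV. w i j * (exp (b j) - exp (a i) - exp (a i) * (b j - a i)))
      = ?Z' - ?Z - - \<eta> * (?Z * trace (P ** gibbs_state H))" .
  have "(\<Sum>i\<in>UNIV. \<Sum>j\<in>UNIV. w i j * (exp (b j) - exp (a i) - exp (a i) * (b j - a i)))
      \<le> (\<Sum>i\<in>UNIV. \<Sum>j\<in>UNIV. w i j * ((b j - a i)\<^sup>2 * (exp (a i) + exp (b j))))"
    by (intro sum_mono mult_left_mono exp_taylor_remainder_le wpos)
  also have "\<dots> = (\<Sum>i\<in>UNIV. \<Sum>j\<in>UNIV. exp (a i) * (w i j * (b j - a i)\<^sup>2))
      + (\<Sum>i\<in>UNIV. \<Sum>j\<in>UNIV. exp (b j) * (w i j * (b j - a i)\<^sup>2))"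
    unfolding sum.distrib[symmetric] by (intro sum.cong refl) (simp add: algebra_simps)
  \<comment> \<open>The order of summation is exchanged only in the second half, so that the inner
    sums are those of \<open>sqrow\<close> and \<open>sqcol\<close>.\<close>
  also have "\<dots> = (\<Sum>i\<in>UNIV. exp (a i) * (\<Sum>j\<in>UNIV. w i j * (b j - a i)\<^sup>2))
      + (\<Sum>j\<in>UNIV. exp (b j) * (\<Sum>i\<in>UNIV. w i j * (b j - a i)\<^sup>2))"
    unfolding sum_distrib_left by (intro arg_cong2[where f = "(+)"] refl sum.swap)
  also have "\<dots> \<le> (\<Sum>i\<in>UNIV. exp (a i) * \<eta>\<^sup>2) + (\<Sum>j\<in>UNIV. exp (b j) * \<eta>\<^sup>2)"
    by (intro add_mono sum_mono mult_left_mono sqrow sqcol) auto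
  also have "\<dots> = (?Z + ?Z') * \<eta>\<^sup>2" unfolding Z Z' by (simp add: sum_distrib_right distrib_right)
  finally show ?thesis unfolding lhs H'_def[symmetric] by (simp add: algebra_simps)
qed

text \<open>Logarithmic form of the previous bound. The constant 4 is chosen for \<eta> = \<epsilon>
  / 8, where the quadratic loss is exactly half of the gain \<eta> * \<epsilon>.\<close>

lemma ln_partition_function_update_le:
  fixes H P :: "real^'n^'n"
  assumes H: "symmetric_mat H" and P: "symmetric_mat P" "operator_norm P \<le> 1"
    and \<eta>: "0 \<le> \<eta>" "\<eta> \<le> 1 / 4"
  shows "ln (partition_function (H + \<eta> *\<^sub>R P))
    \<le> ln (partition_function H) - \<eta> * trace (P ** gibbs_state H) + 4 * \<eta>\<^sup>2"
proof -
  let ?Z = "partition_function H" and ?Z' = "partition_function (H + \<eta> *\<^sub>R P)"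
  define r where "r = trace (P ** gibbs_state H)"
  have pos: "?Z > 0" "?Z' > 0"
    using partition_function_pos symmetric_mat_add_scaleR H P(1) by blast+
  have \<eta>2: "\<eta>\<^sup>2 \<le> 1 / 16" using power_mono[OF \<eta>(2,1), of 2] by (simp add: power2_eq_square)
  have "\<bar>r\<bar> \<le> 1" unfolding r_def
    by (rule abs_trace_mult_quantum_state_le[OF gibbs_state_in_quantum_states[OF H] P])
  then have "\<eta> * r \<le> 1 / 4" using \<eta> mult_left_mono[of r 1 \<eta>] by linarith
  \<comment> \<open>Both factors multiplying the partition functions must be positive before
    logarithms are taken; the bound on \<eta> ensures this.\<close>
  then have x: "1 + \<eta>\<^sup>2 - \<eta> * r > 0" using zero_le_power2[of \<eta>] by linarith
  have "ln ?Z' + ln (1 - \<eta>\<^sup>2) = ln (?Z' * (1 - \<eta>\<^sup>2))"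
    using pos \<eta>2 by (intro ln_mult_pos[symmetric]) auto
  also have "\<dots> \<le> ln (?Z * (1 + \<eta>\<^sup>2 - \<eta> * r))"
    using partition_function_update_le[OF H P, of \<eta>] pos \<eta>2 x unfolding r_def[symmetric]
    by (intro ln_mono) auto
  also have "\<dots> = ln ?Z + ln (1 + \<eta>\<^sup>2 - \<eta> * r)" using pos x by (intro ln_mult_pos) auto
  also have "ln (1 + \<eta>\<^sup>2 - \<eta> * r) \<le> \<eta>\<^sup>2 - \<eta> * r"
    using ln_le_minus_one[OF x] by simp
  finally have 1: "ln ?Z' \<le> ln ?Z + \<eta>\<^sup>2 - \<eta> * r - ln (1 - \<eta>\<^sup>2)" by simp
  \<comment> \<open>From \<open>- x - 2 * x\<^sup>2 \<le> ln (1 - x)\<close> at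
    \<open>x = \<eta>\<^sup>2\<close>, whose quadratic term is at most \<open>x / 8\<close>.\<close>
  have "- ln (1 - \<eta>\<^sup>2) \<le> 2 * \<eta>\<^sup>2"
    using ln_one_minus_pos_lower_bound[of "\<eta>\<^sup>2"] \<eta>2 mult_left_mono[OF \<eta>2, of "\<eta>\<^sup>2"]
    unfolding power2_eq_square[of "\<eta>\<^sup>2"] using zero_le_power2[of \<eta>] by linarith
  with 1 have "ln ?Z' \<le> ln ?Z - \<eta> * r + 3 * \<eta>\<^sup>2" by simp
  then show ?thesis unfolding r_def using zero_le_power2[of \<eta>] by linarith
qed

section \<open>Analysis of the update loop\<close>

lemma query_in_order_eq_None_iff:
  "query_in_order orcs X = None \<longleftrightarrow> (\<forall>orc\<in>set orcs. orc X = None)"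
  by (induction orcs) (auto split: option.splits)

lemma query_in_order_eq_SomeD:
  "query_in_order orcs X = Some P \<Longrightarrow> \<exists>orc\<in>set orcs. orc X = Some P"
  by (induction orcs) (auto split: option.splits)

text \<open>Oracles are constrained on symmetric inputs only, so the induction carries the symmetry
  of \<open>H\<close>, which passes to its Gibbs state.\<close>

lemma hu_loop_returns_gibbs_state:
  assumes "hu_loop orcs \<epsilon> t H (gibbs_state H) = Some (\<rho>, H')" "symmetric_mat H"
    and "\<And>orc X P. orc \<in> set orcs \<Longrightarrow> symmetric_mat X \<Longrightarrow> orc X = Some P \<Longrightarrow> symmetric_mat P"
  shows "symmetric_mat H' \<and> \<rho> = gibbs_state H' \<and> (\<forall>orc\<in>set orcs. orc \<rho> = None)"
  using assms(1,2)
proof (induction t arbitrary: H)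
  case (Suc t)
  have sym: "symmetric_mat (gibbs_state H)"
    using gibbs_state_in_quantum_states[OF Suc.prems(2)] by (simp add: quantum_states_def psd_def)
  show ?case
  proof (cases "query_in_order orcs (gibbs_state H)")
    case None
    then have "\<rho> = gibbs_state H" "H' = H" using Suc.prems(1) by auto
    then show ?thesis using None Suc.prems(2) by (simp add: query_in_order_eq_None_iff)
  next
    case (Some P)
    then have "symmetric_mat P" using query_in_order_eq_SomeD[OF Some] assms(3) sym by blast
    then have "symmetric_mat (H + (\<epsilon> / 8) *\<^sub>R P)"
      using Suc.prems(2) by (simp add: symmetric_mat_add_scaleR)
    moreover have "hu_loop orcs \<epsilon> t (H + (\<epsilon> / 8) *\<^sub>R P) (gibbs_state (H + (\<epsilon> / 8) *\<^sub>R P)) = Some (\<rho>, H')"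
      using Suc.prems(1) Some by (simp add: Let_def)
    ultimately show ?thesis by (rule Suc.IH[rotated])
  qed
qed simp

lemma trace_mult_diff: "trace (P ** (X - Y)) = trace (P ** X) - trace (P ** (Y :: real^'n^'n))"
  by (simp add: trace_def matrix_matrix_mult_def right_diff_distrib sum_subtractf)

lemma trace_add_scaleR_mult:
  "trace ((H + c *\<^sub>R P) ** Y) = trace (H ** Y) + c * trace (P ** (Y :: real^'n^'n))"
  by (simp add: trace_def matrix_matrix_mult_def distrib_right sum.distrib sum_distrib_left mult.assoc)

text \<open>
  The potential is the relative entropy of \<open>Y\<close> to the Gibbs state plus the entropy of \<open>Y\<close>.
\<close>

lemma hu_loop_exhausted_imp_potential_ge:
  fixes Y :: "real^'n^'n"
  assumes "hu_loop orcs \<epsilon> t H (gibbs_state H) = None" "symmetric_mat H"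
    and Y: "Y \<in> quantum_states" and \<epsilon>: "\<epsilon> > 0"
    and orcs: "\<And>orc X P. orc \<in> set orcs \<Longrightarrow> symmetric_mat X \<Longrightarrow> orc X = Some P \<Longrightarrow>
      symmetric_mat P \<and> operator_norm P \<le> 1 \<and> trace (P ** (X - Y)) \<ge> \<epsilon>"
  shows "real t * (\<epsilon>\<^sup>2 / 16) \<le> ln (partition_function H) + trace (H ** Y)"
  using assms(1,2)
proof (induction t arbitrary: H)
  case 0
  then show ?case using neg_trace_mult_le_ln_partition_function[OF _ Y, of H] by simp
next
  case (Suc t)
  let ?\<rho> = "gibbs_state H"
  have \<rho>: "?\<rho> \<in> quantum_states" by (rule gibbs_state_in_quantum_states[OF Suc.prems(2)])
  then have sym: "symmetric_mat ?\<rho>" by (simp add: quantum_states_def psd_def)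
  obtain P where P: "query_in_order orcs ?\<rho> = Some P"
    using Suc.prems(1) by (cases "query_in_order orcs ?\<rho>") auto
  then have Ps: "symmetric_mat P" "operator_norm P \<le> 1" and sep: "trace (P ** (?\<rho> - Y)) \<ge> \<epsilon>"
    using query_in_order_eq_SomeD[OF P] orcs sym by blast+
  define H' where "H' = H + (\<epsilon> / 8) *\<^sub>R P"
  have "symmetric_mat H'" unfolding H'_def using Suc.prems(2) Ps(1) by (rule symmetric_mat_add_scaleR)
  then have IH: "real t * (\<epsilon>\<^sup>2 / 16) \<le> ln (partition_function H') + trace (H' ** Y)"
    using Suc.IH[of H'] Suc.prems(1) P by (simp add: Let_def H'_def)
  have sep': "\<epsilon> \<le> trace (P ** ?\<rho>) - trace (P ** Y)" using sep by (simp add: trace_mult_diff)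
  \<comment> \<open>This gives \<open>\<epsilon> / 8 \<le> 1 / 4\<close>, as the logarithmic bound
    requires.\<close>
  have "\<epsilon> \<le> 2"
    using sep' abs_trace_mult_quantum_state_le[OF \<rho> Ps] abs_trace_mult_quantum_state_le[OF Y Ps]
    by linarith
  then have "ln (partition_function H')
      \<le> ln (partition_function H) - \<epsilon> / 8 * trace (P ** ?\<rho>) + 4 * (\<epsilon> / 8)\<^sup>2"
    unfolding H'_def using \<epsilon> by (intro ln_partition_function_update_le Suc.prems(2) Ps) auto
  moreover have "trace (H' ** Y) = trace (H ** Y) + \<epsilon> / 8 * trace (P ** Y)"
    unfolding H'_def by (rule trace_add_scaleR_mult)
  moreover have "\<epsilon> / 8 * \<epsilon> \<le> \<epsilon> / 8 * (trace (P ** ?\<rho>) - trace (P ** Y))"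
    using sep' \<epsilon> by (intro mult_left_mono) auto
  \<comment> \<open>The two trace terms combine into the separation gap, so the potential changes by
    at most \<open>- \<epsilon>\<^sup>2 / 8 + \<epsilon>\<^sup>2 / 16\<close>.\<close>
  ultimately show ?case
    using IH by (simp add: power2_eq_square algebra_simps)
qed

section \<open>Oracle answers and the final dichotomy\<close>

lemma separation_oracle_NoneD:
  assumes "separation_oracle \<epsilon> C orc" "symmetric_mat X" "orc X = None"
  shows "\<exists>Y\<in>C. trace_norm (X - Y) \<le> \<epsilon>"
  using assms(1)[unfolded separation_oracle_def, rule_format, OF assms(2)] assms(3)
  by (auto simp: is_arg_min_def)

lemma separation_oracle_SomeD:
  assumes "separation_oracle \<epsilon> C orc" "symmetric_mat X" "orc X = Some P"
  shows "symmetric_mat P \<and> operator_norm P \<le> 1 \<and> (\<forall>Y\<in>C. trace (P ** (X - Y)) \<ge> \<epsilon>)"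
  using assms(1)[unfolded separation_oracle_def, rule_format, OF assms(2)] assms(3) by simp

text \<open>The Gram matrix is unchanged by a sign. This reconciles the oracle's
  \<open>X - Y\<close> with the \<open>Y - \<rho>\<close> of the conclusion.\<close>

lemma trace_norm_minus_commute: "trace_norm (X - Y) = trace_norm (Y - X)"
proof -
  have flip: "(X - Y) $ k $ i * (X - Y) $ k $ j = (Y - X) $ k $ i * (Y - X) $ k $ j" for i j k
    by (simp add: algebra_simps)
  have "transpose (X - Y) ** (X - Y) = transpose (Y - X) ** (Y - X)"
    by (simp only: matrix_matrix_mult_def transpose_def vec_lambda_beta flip)
  then show ?thesis by (simp only: trace_norm_def)
qed

theorem theorem2p3:
  fixes C :: "nat \<Rightarrow> (real^'n^'n) set"
    and orc :: "nat \<Rightarrow> real^'n^'n \<Rightarrow> (real^'n^'n) option"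
    and m :: nat and \<epsilon> :: real
  assumes "\<forall>i\<in>{1..m}. closed (C i) \<and> convex (C i) \<and> (\<forall>Y\<in>C i. symmetric_mat Y)"
    and "\<epsilon> > 0"
    and "\<forall>i\<in>{1..m}. separation_oracle \<epsilon> (C i) (orc i)"
  shows "(\<exists>\<rho> H. hamiltonian_updates (map orc [1..<Suc m]) \<epsilon>
                    (nat \<lceil>16 * ln (real CARD('n)) / \<epsilon>\<^sup>2\<rceil> + 1) = Some (\<rho>, H) \<and>
                  \<rho> \<in> quantum_states \<and>
                  (\<forall>i\<in>{1..m}. \<exists>Y\<in>C i. trace_norm (Y - \<rho>) \<le> \<epsilon>))
         \<or> quantum_states \<inter> (\<Inter>i\<in>{1..m}. C i) = {}"
proof -
  define orcs where "orcs = map orc [1..<Suc m]"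
  define T where "T = nat \<lceil>16 * ln (real CARD('n)) / \<epsilon>\<^sup>2\<rceil> + 1"
  have set_orcs: "set orcs = orc ` {1..m}" by (auto simp: orcs_def)
  have sym0: "symmetric_mat (0 :: real^'n^'n)"
    by (simp add: symmetric_mat_def transpose_def vec_eq_iff)
  have run: "hamiltonian_updates orcs \<epsilon> T = hu_loop orcs \<epsilon> T 0 (gibbs_state 0)"
    by (simp add: hamiltonian_updates_def gibbs_state_0)
  \<comment> \<open>A query does not record which oracle answered, so the index \<open>i\<close>
    stays existential; a point of the intersection is separated whatever \<open>i\<close>
    is.\<close>
  have answer: "symmetric_mat P \<and> (\<exists>i\<in>{1..m}. operator_norm P \<le> 1 \<and> (\<forall>Y\<in>C i. \<epsilon> \<le> trace (P ** (X - Y))))"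
    if f: "f \<in> set orcs" and X: "symmetric_mat X" "f X = Some P" for X P f
  proof -
    obtain i where i: "i \<in> {1..m}" "f = orc i" using f unfolding set_orcs by blast
    with assms(3) have "separation_oracle \<epsilon> (C i) f" by simp
    from separation_oracle_SomeD[OF this X] i(1) show ?thesis by blast
  qed
  have answers_sym: "symmetric_mat P"
    if "f \<in> set orcs" "symmetric_mat X" "f X = Some P" for X P f
    using answer[OF that] by blast
  have separates: "symmetric_mat P \<and> operator_norm P \<le> 1 \<and> \<epsilon> \<le> trace (P ** (X - Y))"
    if "Y \<in> (\<Inter>i\<in>{1..m}. C i)" "f \<in> set orcs" "symmetric_mat X" "f X = Some P" for Y X P f
    using answer[OF that(2-4)] that(1) by blast
  show ?thesis
  proof (cases "hu_loop orcs \<epsilon> T 0 (gibbs_state 0)")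
    case None
    have "Y \<notin> (\<Inter>i\<in>{1..m}. C i)" if Y: "Y \<in> quantum_states" for Y
    proof
      assume "Y \<in> (\<Inter>i\<in>{1..m}. C i)"
      from hu_loop_exhausted_imp_potential_ge[OF None sym0 Y assms(2) separates[OF this]]
      have "real T * (\<epsilon>\<^sup>2 / 16) \<le> ln (real CARD('n))"
        by (simp add: partition_function_0 trace_def matrix_matrix_mult_def)
      then have "real T \<le> 16 * ln (real CARD('n)) / \<epsilon>\<^sup>2" using assms(2) by (simp add: field_simps)
      \<comment> \<open>The extra iteration in \<open>T\<close> makes \<open>T\<close> strictly
        exceed the bound.\<close>
      then show False unfolding T_def by linarith
    qed
    then show ?thesis by blast
  next
    case (Some p)
    obtain \<rho> H where p: "p = (\<rho>, H)" by (cases p)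
    have fin: "symmetric_mat H \<and> \<rho> = gibbs_state H \<and> (\<forall>f\<in>set orcs. f \<rho> = None)"
      by (rule hu_loop_returns_gibbs_state[OF Some[unfolded p] sym0]) (rule answers_sym)
    have \<rho>: "\<rho> \<in> quantum_states" using fin gibbs_state_in_quantum_states by blast
    then have "symmetric_mat \<rho>" by (simp add: quantum_states_def psd_def)
    then have "\<exists>Y\<in>C i. trace_norm (\<rho> - Y) \<le> \<epsilon>" if "i \<in> {1..m}" for i
      using that assms(3) fin set_orcs by (intro separation_oracle_NoneD[of \<epsilon> "C i" "orc i" \<rho>]) auto
    then have "\<forall>i\<in>{1..m}. \<exists>Y\<in>C i. trace_norm (Y - \<rho>) \<le> \<epsilon>"
      by (simp only: trace_norm_minus_commute[of \<rho>]) blast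
    moreover have "hamiltonian_updates orcs \<epsilon> T = Some (\<rho>, H)" using run Some p by simp
    ultimately show ?thesis using \<rho> unfolding orcs_def T_def by blast
  qed
qed

end
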